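(* Let $M\ge1$, $B_c>0$, and for $m=1,\dots,M$ let $\Gamma_{1,m}\ge\Gamma_{2,m}>0$ and $R_{1,m}^{\min},R_{2,m}^{\min}\ge0$. Put $$A_{l,m}=2^{R_{l,m}^{\min}/B_c}\ (l=1,2),\quad \Upsilon_m=\frac{A_{2,m}(A_{1,m}-1)}{\Gamma_{1,m}}+\frac{A_{2,m}-1}{\Gamma_{2,m}},$$ and assume $A_{2,m}\ge2$ for all $m$ and $P\ge\sum_{m=1}^M\Upsilon_m$. Consider $$\max_{\boldsymbol q}\ \sum_{m=1}^Mf_m^{\mathrm{SR2}\star}(q_m)\quad\text{s.t.}\quad\sum_{m=1}^Mq_m\le P,\ \ q_m\ge\Upsilon_m\ \forall m,$$ where $$f_m^{\mathrm{SR2}\star}(q_m)=B_c\log\frac{A_{2,m}\Gamma_{2,m}-A_{2,m}\Gamma_{1,m}+\Gamma_{1,m}\Gamma_{2,m}q_m+\Gamma_{1,m}}{A_{2,m}\Gamma_{2,m}}+R_{2,m}^{\min}.$$ The optimal solution is given by $$q_m^\star=\left[\frac{B_c}{\lambda}-\frac{A_{2,m}}{\Gamma_{1,m}}+\frac{A_{2,m}}{\Gamma_{2,m}}-\frac1{\Gamma_{2,m}}\right]_{\Upsilon_m}^{\infty},\qquad m=1,\dots,M,$$ where $\lambda>0$ is chosen such that $\sum_{m=1}^Mq_m^\star=P$.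
   Context: Notation: $[x]_a^\infty=\max\{x,a\}$; $\log$ is the base-2 logarithm. Here $q_m$ is the power budget of channel $m$ (two NOMA users per channel, bandwidth $B_c$, channel-to-noise ratios $\Gamma_{l,m}$, rate thresholds $R_{l,m}^{\min}$), and $f_m^{\mathrm{SR2}\star}(q_m)$ is the optimal sum rate on channel $m$ subject to the rate thresholds. *)

theory Defs imports Complex_Main begin

text \<open>
  Channels are \<open>m \<in> {1..M}\<close>, the users of a channel are \<open>l \<in> {1, 2}\<close>; \<open>\<Gamma> l m\<close> and \<open>R l m\<close> are the
  channel-to-noise ratio and the rate threshold of user \<open>l\<close> on channel \<open>m\<close>. A power allocation
  is a function \<open>q :: nat \<Rightarrow> real\<close>, of which only the values on \<open>{1..M}\<close> matter.
\<close>

definition rate_factor :: "real \<Rightarrow> (nat \<Rightarrow> nat \<Rightarrow> real) \<Rightarrow> nat \<Rightarrow> nat \<Rightarrow> real" where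
  "rate_factor Bc R l m = 2 powr (R l m / Bc)"

definition min_budget ::
    "real \<Rightarrow> (nat \<Rightarrow> nat \<Rightarrow> real) \<Rightarrow> (nat \<Rightarrow> nat \<Rightarrow> real) \<Rightarrow> nat \<Rightarrow> real" where
  "min_budget Bc \<Gamma> R m =
     rate_factor Bc R 2 m * (rate_factor Bc R 1 m - 1) / \<Gamma> 1 m
       + (rate_factor Bc R 2 m - 1) / \<Gamma> 2 m"

definition sum_rate ::
    "real \<Rightarrow> (nat \<Rightarrow> nat \<Rightarrow> real) \<Rightarrow> (nat \<Rightarrow> nat \<Rightarrow> real) \<Rightarrow> nat \<Rightarrow> real \<Rightarrow> real" where
  "sum_rate Bc \<Gamma> R m x =
     Bc * log 2 ((rate_factor Bc R 2 m * \<Gamma> 2 m - rate_factor Bc R 2 m * \<Gamma> 1 m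
                   + \<Gamma> 1 m * \<Gamma> 2 m * x + \<Gamma> 1 m)
                 / (rate_factor Bc R 2 m * \<Gamma> 2 m))
       + R 2 m"

definition total_sum_rate ::
    "nat \<Rightarrow> real \<Rightarrow> (nat \<Rightarrow> nat \<Rightarrow> real) \<Rightarrow> (nat \<Rightarrow> nat \<Rightarrow> real) \<Rightarrow> (nat \<Rightarrow> real) \<Rightarrow> real" where
  "total_sum_rate M Bc \<Gamma> R q = (\<Sum>m=1..M. sum_rate Bc \<Gamma> R m (q m))"

definition feasible ::
    "nat \<Rightarrow> real \<Rightarrow> real \<Rightarrow> (nat \<Rightarrow> nat \<Rightarrow> real) \<Rightarrow> (nat \<Rightarrow> nat \<Rightarrow> real) \<Rightarrow> (nat \<Rightarrow> real) \<Rightarrow> bool" where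
  "feasible M P Bc \<Gamma> R q \<longleftrightarrow>
     (\<Sum>m=1..M. q m) \<le> P \<and> (\<forall>m\<in>{1..M}. q m \<ge> min_budget Bc \<Gamma> R m)"

text \<open>
  The multiplier is only determined by the budget equation, so the factor \<open>ln 2\<close> from
  differentiating \<open>log 2\<close> is absorbed into \<open>lam\<close>.
\<close>

definition water_filling ::
    "real \<Rightarrow> (nat \<Rightarrow> nat \<Rightarrow> real) \<Rightarrow> (nat \<Rightarrow> nat \<Rightarrow> real) \<Rightarrow> real \<Rightarrow> nat \<Rightarrow> real" where
  "water_filling Bc \<Gamma> R lam m =
     max (Bc / lam - rate_factor Bc R 2 m / \<Gamma> 1 m + rate_factor Bc R 2 m / \<Gamma> 2 m - 1 / \<Gamma> 2 m)
         (min_budget Bc \<Gamma> R m)"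

end

theory Submission imports Defs begin

text \<open>
  On channel \<open>m\<close> the sum rate is \<open>Bc * log 2 (x + s)\<close> up to an additive constant, and the bound
  \<open>x \<ge> min_budget\<close> reads \<open>x + s \<ge> L\<close> with \<open>L > 0\<close>; water filling sets \<open>x + s = max (Bc / lam) L\<close>.
  The tangent of the logarithm there, together with complementary slackness, bounds the gain on
  each channel by \<open>lam / ln 2\<close> times the change of power, strictly unless the power is unchanged.
  Summing over the channels, the total change of power is at most \<open>0\<close>, so every other feasible
  allocation is strictly worse. The multiplier exists by the intermediate value theorem.
\<close>

text \<open>This is the \<open>s\<close> of the overview: up to the factor
  \<open>\<Gamma> 1 m / rate_factor Bc R 2 m\<close>, the argument of the logarithm is
  \<open>x + s\<close>. It may be negative, so \<open>x + s > 0\<close> has to come from the lower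
  bound on \<open>x\<close>.\<close>

definition level_offset :: "real \<Rightarrow> (nat \<Rightarrow> nat \<Rightarrow> real) \<Rightarrow> (nat \<Rightarrow> nat \<Rightarrow> real) \<Rightarrow> nat \<Rightarrow> real" where
  "level_offset Bc \<Gamma> R m =
     rate_factor Bc R 2 m / \<Gamma> 1 m - rate_factor Bc R 2 m / \<Gamma> 2 m + 1 / \<Gamma> 2 m"

text \<open>The \<open>L\<close> of the overview, the value of \<open>x + s\<close> at the minimum
  budget. In this form its positivity is visible.\<close>

definition min_level :: "real \<Rightarrow> (nat \<Rightarrow> nat \<Rightarrow> real) \<Rightarrow> (nat \<Rightarrow> nat \<Rightarrow> real) \<Rightarrow> nat \<Rightarrow> real" where
  "min_level Bc \<Gamma> R m = rate_factor Bc R 1 m * rate_factor Bc R 2 m / \<Gamma> 1 m"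

lemma rate_factor_pos: "rate_factor Bc R l m > 0"
  by (simp add: rate_factor_def)

lemma min_level_pos: "\<Gamma> 1 m > 0 \<Longrightarrow> min_level Bc \<Gamma> R m > 0"
  by (simp add: min_level_def rate_factor_pos)

lemma min_budget_eq: "min_budget Bc \<Gamma> R m = min_level Bc \<Gamma> R m - level_offset Bc \<Gamma> R m"
  by (simp add: min_budget_def min_level_def level_offset_def algebra_simps diff_divide_distrib)

lemma water_filling_eq:
  "water_filling Bc \<Gamma> R lam m = max (Bc / lam) (min_level Bc \<Gamma> R m) - level_offset Bc \<Gamma> R m"
  unfolding water_filling_def min_budget_eq by (simp add: level_offset_def max_def)

lemma sum_rate_eq:
  assumes "\<Gamma> 1 m > 0" "\<Gamma> 2 m > 0" "x + level_offset Bc \<Gamma> R m > 0"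
  shows "sum_rate Bc \<Gamma> R m x =
    Bc / ln 2 * (ln (\<Gamma> 1 m / rate_factor Bc R 2 m) + ln (x + level_offset Bc \<Gamma> R m)) + R 2 m"
proof -
  define A where "A = rate_factor Bc R 2 m"
  have A: "A > 0" by (simp add: A_def rate_factor_pos)
  have "(A * \<Gamma> 2 m - A * \<Gamma> 1 m + \<Gamma> 1 m * \<Gamma> 2 m * x + \<Gamma> 1 m) / (A * \<Gamma> 2 m)
      = \<Gamma> 1 m / A * (x + level_offset Bc \<Gamma> R m)"
    using assms(1,2) A unfolding level_offset_def A_def[symmetric] by (simp add: field_simps)
  moreover have "ln (\<Gamma> 1 m / A * (x + level_offset Bc \<Gamma> R m))
      = ln (\<Gamma> 1 m / A) + ln (x + level_offset Bc \<Gamma> R m)"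
    using assms A by (intro ln_mult_pos) auto
  ultimately show ?thesis
    by (simp add: sum_rate_def log_def A_def)
qed

text \<open>Strict concavity of \<open>ln\<close>: with \<open>t = x / y\<close>, the bound
  \<open>ln t \<le> t - 1\<close> is an equality only at \<open>t = 1\<close>.\<close>

lemma ln_tangent_less:
  fixes x y :: real
  assumes "x > 0" "y > 0" "x \<noteq> y"
  shows "ln x < ln y + (x - y) / y"
proof -
  have "ln (x / y) \<le> x / y - 1"
    using assms by (intro ln_le_minus_one) auto
  moreover have "ln (x / y) \<noteq> x / y - 1"
    using assms ln_eq_minus_one[of "x / y"] by auto
  ultimately show ?thesis
    using assms by (simp add: ln_div diff_divide_distrib)
qed

text \<open>Here \<open>lam / ln 2\<close> is a price of power common to all channels, which lets
  the bounds be added up later. Strictness is what gives uniqueness of the optimum.\<close>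

lemma sum_rate_less_tangent:
  assumes "Bc > 0" "lam > 0" "\<Gamma> 1 m > 0" "\<Gamma> 2 m > 0"
    and x: "x \<ge> min_budget Bc \<Gamma> R m" "x \<noteq> water_filling Bc \<Gamma> R lam m"
  shows "sum_rate Bc \<Gamma> R m x <
    sum_rate Bc \<Gamma> R m (water_filling Bc \<Gamma> R lam m)
      + lam / ln 2 * (x - water_filling Bc \<Gamma> R lam m)"
proof -
  define w where "w = water_filling Bc \<Gamma> R lam m"
  define y where "y = x + level_offset Bc \<Gamma> R m"
  define v where "v = w + level_offset Bc \<Gamma> R m"
  have v: "v = max (Bc / lam) (min_level Bc \<Gamma> R m)"
    by (simp add: v_def w_def water_filling_eq)
  have y: "y \<ge> min_level Bc \<Gamma> R m"
    using x(1) by (simp add: y_def min_budget_eq)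
  have pos: "y > 0" "v > 0"
    using y min_level_pos[of \<Gamma> m Bc R] assms(3) by (auto simp: v)
  \<comment> \<open>Complementary slackness: either the level is \<open>Bc / lam\<close> and both
    sides agree, or the lower bound is active and the power can only increase.\<close>
  have "(y - v) / v \<le> (y - v) / (Bc / lam)"
  proof (cases "v = Bc / lam")
    case False
    then have "v \<ge> Bc / lam" "y - v \<ge> 0"
      using y by (auto simp: v)
    then show ?thesis
      using assms by (intro divide_left_mono) (use pos in auto)
  qed simp
  moreover have "ln y < ln v + (y - v) / v"
    using pos x(2) by (intro ln_tangent_less) (auto simp: y_def v_def w_def)
  ultimately have "ln y < ln v + (y - v) / (Bc / lam)"
    by linarith
  then have "Bc / ln 2 * ln y < Bc / ln 2 * (ln v + (y - v) / (Bc / lam))"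
    using assms(1) by (intro mult_strict_left_mono) auto
  also have "\<dots> = Bc / ln 2 * ln v + lam / ln 2 * (x - w)"
    using assms(1) by (simp add: y_def v_def field_simps)
  finally show ?thesis
    using pos sum_rate_eq[of \<Gamma> m x Bc R] sum_rate_eq[of \<Gamma> m w Bc R] assms(3,4)
    by (simp add: y_def v_def w_def[symmetric] distrib_left)
qed

lemma total_sum_rate_less:
  assumes "Bc > 0" "lam > 0"
    and \<Gamma>: "\<And>m. m \<in> {1..M} \<Longrightarrow> \<Gamma> 1 m > 0 \<and> \<Gamma> 2 m > 0"
    and P: "(\<Sum>m=1..M. water_filling Bc \<Gamma> R lam m) = P"
    and q: "feasible M P Bc \<Gamma> R q"
    and k: "k \<in> {1..M}" "q k \<noteq> water_filling Bc \<Gamma> R lam k"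
  shows "total_sum_rate M Bc \<Gamma> R q < total_sum_rate M Bc \<Gamma> R (water_filling Bc \<Gamma> R lam)"
proof -
  let ?w = "water_filling Bc \<Gamma> R lam"
  have less: "sum_rate Bc \<Gamma> R m (q m) < sum_rate Bc \<Gamma> R m (?w m) + lam / ln 2 * (q m - ?w m)"
    if "m \<in> {1..M}" "q m \<noteq> ?w m" for m
    using that q \<Gamma> assms(1,2) by (intro sum_rate_less_tangent) (auto simp: feasible_def)
  have "total_sum_rate M Bc \<Gamma> R q
      < (\<Sum>m=1..M. sum_rate Bc \<Gamma> R m (?w m) + lam / ln 2 * (q m - ?w m))"
    unfolding total_sum_rate_def
  proof (rule sum_strict_mono_ex1)
    show "\<forall>m\<in>{1..M}. sum_rate Bc \<Gamma> R m (q m)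
        \<le> sum_rate Bc \<Gamma> R m (?w m) + lam / ln 2 * (q m - ?w m)"
    proof
      fix m assume "m \<in> {1..M}"
      then show "sum_rate Bc \<Gamma> R m (q m) \<le> sum_rate Bc \<Gamma> R m (?w m) + lam / ln 2 * (q m - ?w m)"
        using less[of m] by (cases "q m = ?w m") auto
    qed
    show "\<exists>m\<in>{1..M}. sum_rate Bc \<Gamma> R m (q m)
        < sum_rate Bc \<Gamma> R m (?w m) + lam / ln 2 * (q m - ?w m)"
      using less k by blast
  qed simp
  also have "\<dots> = total_sum_rate M Bc \<Gamma> R ?w + lam / ln 2 * ((\<Sum>m=1..M. q m) - P)"
    by (simp add: total_sum_rate_def P[symmetric] sum.distrib sum_distrib_left sum_subtractf
        right_diff_distrib)
  \<comment> \<open>Water filling spends exactly \<open>P\<close> and \<open>q\<close> at most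
    \<open>P\<close>, so the price term is not positive.\<close>
  also have "\<dots> \<le> total_sum_rate M Bc \<Gamma> R ?w"
    using q assms(2) by (simp add: feasible_def mult_nonneg_nonpos divide_nonpos_pos)
  finally show ?thesis .
qed

lemma water_filling_feasible:
  assumes "(\<Sum>m=1..M. water_filling Bc \<Gamma> R lam m) = P"
  shows "feasible M P Bc \<Gamma> R (water_filling Bc \<Gamma> R lam)"
  using assms by (simp add: feasible_def water_filling_def)

lemma is_arg_max_iff_water_filling:
  assumes "Bc > 0" "lam > 0"
    and \<Gamma>: "\<And>m. m \<in> {1..M} \<Longrightarrow> \<Gamma> 1 m > 0 \<and> \<Gamma> 2 m > 0"
    and P: "(\<Sum>m=1..M. water_filling Bc \<Gamma> R lam m) = P"
  shows "is_arg_max (total_sum_rate M Bc \<Gamma> R) (feasible M P Bc \<Gamma> R) q \<longleftrightarrow>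
    (\<forall>m\<in>{1..M}. q m = water_filling Bc \<Gamma> R lam m)"
    (is "?opt \<longleftrightarrow> ?eq")
proof
  let ?w = "water_filling Bc \<Gamma> R lam"
  have less: "total_sum_rate M Bc \<Gamma> R p < total_sum_rate M Bc \<Gamma> R ?w"
    if "feasible M P Bc \<Gamma> R p" "k \<in> {1..M}" "p k \<noteq> ?w k" for p k
    by (rule total_sum_rate_less) (use assms that in blast)+
  show ?eq if ?opt
    using that less water_filling_feasible[OF P] unfolding is_arg_max_def by blast
  show ?opt if ?eq
  proof -
    have "feasible M P Bc \<Gamma> R q"
      using water_filling_feasible[OF P] that by (simp add: feasible_def)
    moreover have q: "total_sum_rate M Bc \<Gamma> R q = total_sum_rate M Bc \<Gamma> R ?w"
      using that by (simp add: total_sum_rate_def)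
    \<comment> \<open>An allocation \<open>p\<close> that agrees with water filling on
      \<open>{1..M}\<close> has the same value, even if it differs elsewhere.\<close>
    moreover have "\<not> total_sum_rate M Bc \<Gamma> R ?w < total_sum_rate M Bc \<Gamma> R p"
      if "feasible M P Bc \<Gamma> R p" for p
    proof (cases "\<forall>m\<in>{1..M}. p m = ?w m")
      case True
      then show ?thesis by (simp add: total_sum_rate_def)
    next
      case False
      then show ?thesis using less[OF that] by force
    qed
    ultimately show ?opt
      by (auto simp: is_arg_max_def)
  qed
qed

text \<open>The unknown is taken to be the water level \<open>\<mu> = Bc / lam\<close>, in which the
  total power \<open>F\<close> is continuous.\<close>

lemma water_filling_exists:
  assumes "M \<ge> 1" "Bc > 0"
    and \<Gamma>: "\<And>m. m \<in> {1..M} \<Longrightarrow> \<Gamma> 1 m > 0"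
    and P: "P \<ge> (\<Sum>m=1..M. min_budget Bc \<Gamma> R m)"
  shows "\<exists>lam>0. (\<Sum>m=1..M. water_filling Bc \<Gamma> R lam m) = P"
proof -
  let ?L = "min_level Bc \<Gamma> R"
  define F where "F \<mu> = (\<Sum>m=1..M. max \<mu> (?L m) - level_offset Bc \<Gamma> R m)" for \<mu>
  define S where "S = (\<Sum>m=1..M. min_budget Bc \<Gamma> R m)"
  \<comment> \<open>At the smallest minimum level every channel sits at its lower bound, so
    \<open>F a = S\<close>. Since \<open>a > 0\<close>, any level above it gives a positive
    multiplier.\<close>
  define a where "a = Min (?L ` {1..M})"
  \<comment> \<open>At this level channel 1 alone absorbs the whole slack \<open>P - S\<close>, and
    no other channel falls below its minimum, so \<open>F b \<ge> P\<close>.\<close>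
  define b where "b = ?L 1 + (P - S)"
  have one: "1 \<in> {1..M}"
    using assms(1) by simp
  have a_le: "a \<le> ?L m" if "m \<in> {1..M}" for m
    using that by (simp add: a_def)
  have "a \<in> ?L ` {1..M}"
    unfolding a_def using one by (intro Min_in) auto
  then have "a > 0"
    using \<Gamma> min_level_pos by auto
  have "F a = S"
    unfolding F_def S_def by (rule sum.cong) (use a_le in \<open>auto simp: min_budget_eq max_def\<close>)
  have "b - ?L 1 \<le> max b (?L 1) - ?L 1"
    by simp
  also have "\<dots> \<le> (\<Sum>m=1..M. max b (?L m) - ?L m)"
    using one by (intro member_le_sum[where f = "\<lambda>m. max b (?L m) - ?L m"]) auto
  also have "\<dots> = F b - S"
    by (simp add: F_def S_def min_budget_eq sum_subtractf)
  finally have "P \<le> F b"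
    by (simp add: b_def)
  moreover have "a \<le> b"
    using a_le[OF one] P by (simp add: b_def S_def)
  moreover have "continuous_on {a..b} F"
    unfolding F_def by (intro continuous_intros)
  ultimately obtain \<mu> where \<mu>: "a \<le> \<mu>" "F \<mu> = P"
    using IVT'[of F a P b] P \<open>F a = S\<close> by (auto simp: S_def)
  have "Bc / \<mu> > 0" "(\<Sum>m=1..M. water_filling Bc \<Gamma> R (Bc / \<mu>) m) = P"
    using \<mu> \<open>a > 0\<close> assms(2) by (auto simp: water_filling_eq F_def)
  then show ?thesis by blast
qed

text \<open>The multiplier is not unique when \<open>P\<close> equals the sum of the minimum
  budgets: every small enough level then works. Hence the claim covers every \<open>lam\<close> that
  meets the budget.\<close>

theorem theorem3:
  fixes M :: nat and Bc P :: real and \<Gamma> R :: "nat \<Rightarrow> nat \<Rightarrow> real"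
  assumes "M \<ge> 1" and "Bc > 0"
    and "\<And>m. m \<in> {1..M} \<Longrightarrow> \<Gamma> 1 m \<ge> \<Gamma> 2 m"
    and "\<And>m. m \<in> {1..M} \<Longrightarrow> \<Gamma> 2 m > 0"
    and "\<And>l m. l \<in> {1, 2} \<Longrightarrow> m \<in> {1..M} \<Longrightarrow> R l m \<ge> 0"
    and "\<And>m. m \<in> {1..M} \<Longrightarrow> rate_factor Bc R 2 m \<ge> 2"
    and "P \<ge> (\<Sum>m=1..M. min_budget Bc \<Gamma> R m)"
  shows "(\<exists>lam>0. (\<Sum>m=1..M. water_filling Bc \<Gamma> R lam m) = P) \<and>
    (\<forall>lam>0. (\<Sum>m=1..M. water_filling Bc \<Gamma> R lam m) = P \<longrightarrow>
       (\<forall>q. is_arg_max (total_sum_rate M Bc \<Gamma> R) (feasible M P Bc \<Gamma> R) q \<longleftrightarrow>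
            (\<forall>m\<in>{1..M}. q m = water_filling Bc \<Gamma> R lam m)))"
proof -
  have \<Gamma>: "\<Gamma> 1 m > 0 \<and> \<Gamma> 2 m > 0" if "m \<in> {1..M}" for m
    using assms(3,4)[OF that] by simp
  then show ?thesis
    using water_filling_exists[of M Bc \<Gamma> R P] is_arg_max_iff_water_filling[of Bc _ M \<Gamma> R P]
      assms(1,2,7) by blast
qed

end
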